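(* Two r.e. sets belonging to the same uniformity equivalence class need not belong to the same one-reducibility equivalence class; that is, there exist r.e. sets $A,B\subseteq\mathbb{N}$ such that $A\sim B$ but $A\not\equiv_1 B$.
   Context: $\mathbb{N}=\{1,2,3,\dots\}$. $A\equiv_1 B$ means that $A$ and $B$ are one-one reducible to each other (via total injective computable functions). A listing of an r.e. set $A\subseteq\mathbb{N}$ is a bijective computable function onto $A$: if $A$ is infinite it is a total computable bijection $h:\mathbb{N}\to A$; if $A$ is finite with $n$ elements it is a bijection $h:\{1,\dots,n\}\to A$. Two listings $h,g$ with the same domain are uniform, $h\sim g$, if $h(i)<h(j)\Leftrightarrow g(i)<g(j)$ for all $i,j$ in the domain. Two r.e. sets $A,B$ of equal cardinality are uniform, $A\sim B$, if there exist a listing $h$ of $A$ and a listing $g$ of $B$ with $h\sim g$. The uniformity equivalence class of $A$ is $[A]_\sim=\{B\subseteq\mathbb{N}: A\sim B\}$. *)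

theory Defs
  imports Main "HOL-Library.Equipollence"
begin

text \<open>Kleene's partial recursive functions of natural-number arguments (starting at 0), given by
  program terms and a big-step evaluation relation. Arities are not tracked: a term denotes a partial
  function on argument lists of every length, and its restriction to lists of any fixed length is
  partial recursive. In \<open>PrimRec\<close> and \<open>Mu\<close> the
  recursion, respectively search, variable is the first argument.\<close>

datatype recf =
    Zero
  | Succ
  | Proj nat
  | Comp recf "recf list"
  | PrimRec recf recf
  | Mu recf

inductive eval :: "recf \<Rightarrow> nat list \<Rightarrow> nat \<Rightarrow> bool" where
  Zero: "eval Zero xs 0"
| Succ: "eval Succ [x] (Suc x)"
| Proj: "i < length xs \<Longrightarrow> eval (Proj i) xs (xs ! i)"
| Comp: "list_all2 (\<lambda>g y. eval g xs y) gs ys \<Longrightarrow> eval f ys z \<Longrightarrow> eval (Comp f gs) xs z"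
| PrimRec_0: "eval f xs y \<Longrightarrow> eval (PrimRec f g) (0 # xs) y"
| PrimRec_Suc: "eval (PrimRec f g) (n # xs) r \<Longrightarrow> eval g (n # r # xs) y
    \<Longrightarrow> eval (PrimRec f g) (Suc n # xs) y"
| Mu: "eval f (n # xs) 0 \<Longrightarrow> (\<forall>m<n. \<exists>y. eval f (m # xs) y \<and> y \<noteq> 0) \<Longrightarrow> eval (Mu f) xs n"

inductive_simps eval_simps:
  "eval Zero xs y"
  "eval Succ xs y"
  "eval (Proj i) xs y"
  "eval (Comp f gs) xs y"
  "eval (PrimRec f g) (0 # xs) y"
  "eval (PrimRec f g) (Suc n # xs) y"
  "eval (Mu f) xs y"

lemma eval_deterministic: "eval f xs y \<Longrightarrow> eval f xs z \<Longrightarrow> y = z"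
proof (induction f xs y arbitrary: z rule: eval.induct)
  case (Comp xs gs ys f w)
  obtain vs where vs: "list_all2 (\<lambda>g y. eval g xs y) gs vs" "eval f vs z"
    using Comp.prems unfolding eval_simps by blast
  have "length ys = length vs"
    using list_all2_lengthD[OF Comp.IH(1)] list_all2_lengthD[OF vs(1)] by (rule trans[OF sym])
  moreover have "ys ! i = vs ! i" if "i < length ys" for i
  proof -
    have "eval (gs ! i) xs (vs ! i)"
      using that calculation by (intro list_all2_nthD2[OF vs(1)]) simp
    then show ?thesis using list_all2_nthD2[OF Comp.IH(1) that] by (elim conjE allE impE)
  qed
  ultimately have "ys = vs"
    by (rule nth_equalityI)
  show ?case using vs(2) unfolding \<open>ys = vs\<close>[symmetric] by (rule Comp.IH(2))
next
  case (PrimRec_Suc f g n xs r y)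
  obtain s where s: "eval (PrimRec f g) (n # xs) s" "eval g (n # s # xs) z"
    using PrimRec_Suc.prems unfolding eval_simps by blast
  have "r = s" using s(1) by (rule PrimRec_Suc.IH(1))
  show ?case using s(2) unfolding \<open>r = s\<close>[symmetric] by (rule PrimRec_Suc.IH(2))
next
  case (Mu f n xs)
  have z: "eval f (z # xs) 0" "\<forall>m<z. \<exists>y. eval f (m # xs) y \<and> 0 < y"
    using Mu.prems unfolding eval_simps by simp_all
  show ?case
  proof (cases n z rule: linorder_cases)
    case less
    then obtain y where "eval f (n # xs) y" "0 < y" using z(2) by blast
    with Mu.IH(1)[of y] show ?thesis by simp
  next
    case greater
    then obtain y :: nat where "eval f (z # xs) 0 \<longrightarrow> y = 0" "y \<noteq> 0" using Mu.IH(2) by blast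
    with z(1) show ?thesis by simp
  qed
qed (simp_all add: eval_simps)

text \<open>\<open>f\<close>, regarded as a partial function with domain exactly \<open>D\<close>, is partial computable;
  the values of \<open>f\<close> outside \<open>D\<close> are irrelevant.\<close>

definition computable_on :: "nat set \<Rightarrow> (nat \<Rightarrow> nat) \<Rightarrow> bool" where
  "computable_on D f \<longleftrightarrow> (\<exists>r. \<forall>x y. eval r [x] y \<longleftrightarrow> x \<in> D \<and> y = f x)"

text \<open>The underlying set of numbers is \<open>{1, 2, 3, \<dots>}\<close>, so 0 is excluded from all sets,
  domains and values considered below.\<close>

abbreviation pos :: "nat set" where
  "pos \<equiv> {1..}"

definition re :: "nat set \<Rightarrow> bool" where
  "re A \<longleftrightarrow> A \<subseteq> pos \<and> (\<exists>f. computable_on A f)"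

definition one_reducible :: "nat set \<Rightarrow> nat set \<Rightarrow> bool" (infix "\<le>\<^sub>1" 50) where
  "A \<le>\<^sub>1 B \<longleftrightarrow> (\<exists>f. computable_on pos f \<and> f ` pos \<subseteq> pos \<and> inj_on f pos \<and>
     (\<forall>x\<in>pos. x \<in> A \<longleftrightarrow> f x \<in> B))"

definition one_equivalent :: "nat set \<Rightarrow> nat set \<Rightarrow> bool" (infix "\<equiv>\<^sub>1" 50) where
  "A \<equiv>\<^sub>1 B \<longleftrightarrow> A \<le>\<^sub>1 B \<and> B \<le>\<^sub>1 A"

definition listing_dom :: "nat set \<Rightarrow> nat set" where
  "listing_dom A = (if finite A then {1..card A} else pos)"

definition listing :: "nat set \<Rightarrow> (nat \<Rightarrow> nat) \<Rightarrow> bool" where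
  "listing A h \<longleftrightarrow> computable_on (listing_dom A) h \<and> bij_betw h (listing_dom A) A"

definition uniform_listings :: "nat set \<Rightarrow> (nat \<Rightarrow> nat) \<Rightarrow> (nat \<Rightarrow> nat) \<Rightarrow> bool" where
  "uniform_listings D h g \<longleftrightarrow> (\<forall>i\<in>D. \<forall>j\<in>D. h i < h j \<longleftrightarrow> g i < g j)"

lemma listing_dom_eqpoll: "A \<approx> B \<Longrightarrow> listing_dom A = listing_dom B"
  using eqpoll_finite_iff[of A B] eqpoll_iff_card[of A B] unfolding listing_dom_def by presburger

text \<open>By the previous lemma, listings of equipollent sets have the same domain.\<close>

definition uniform :: "nat set \<Rightarrow> nat set \<Rightarrow> bool" (infix "\<sim>" 50) where
  "A \<sim> B \<longleftrightarrow> re A \<and> re B \<and> A \<approx> B \<and>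
     (\<exists>h g. listing A h \<and> listing B g \<and> uniform_listings (listing_dom A) h g)"

end

theory Submission
  imports Defs
begin

text \<open>The sets \<open>{1, 2, \<dots>}\<close> and \<open>{2, 3, \<dots>}\<close> are listed uniformly by \<open>i \<mapsto> i\<close> and
  \<open>i \<mapsto> i + 1\<close>. A set that is one-reducible to the whole of \<open>{1, 2, \<dots>}\<close> is
  itself the whole of it, because every value of the reduction lies in the target.\<close>

definition is_zero_recf :: recf where
  "is_zero_recf = PrimRec (Comp Succ [Zero]) Zero"

lemma eval_is_zero_recf: "eval is_zero_recf [x] y \<longleftrightarrow> y = (if x = 0 then 1 else 0)"
proof -
  \<comment> \<open>Exhibiting one value suffices; determinism of \<open>eval\<close> gives its
    uniqueness.\<close>
  have "eval is_zero_recf [x] (if x = 0 then 1 else 0)"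
    unfolding is_zero_recf_def
    by (induction x) (auto simp: eval_simps list_all2_Cons1 split: if_splits)
  then show ?thesis
    using eval_deterministic by blast
qed

definition pred_recf :: recf where
  "pred_recf = PrimRec Zero (Proj 0)"

lemma eval_pred_recf: "eval pred_recf [x] y \<longleftrightarrow> y = x - 1"
proof -
  have "eval pred_recf [x] (x - 1)"
    unfolding pred_recf_def by (induction x) (auto simp: eval_simps)
  then show ?thesis
    using eval_deterministic by blast
qed

text \<open>The search body ignores the search variable and tests only the input: the search stops
  at once for positive input and diverges at 0.\<close>

definition pos_guard :: recf where
  "pos_guard = Mu (Comp is_zero_recf [Proj 1])"

lemma eval_pos_guard: "eval pos_guard [x] y \<longleftrightarrow> 0 < x \<and> y = 0"
  unfolding pos_guard_def
  by (auto simp: eval_simps list_all2_Cons1 eval_is_zero_recf split: if_splits)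

lemma computable_on_pos_id: "computable_on pos (\<lambda>x. x)"
  unfolding computable_on_def
  \<comment> \<open>\<open>Comp\<close> needs values for all its arguments, so
    \<open>pos_guard\<close>, though discarded by \<open>Proj 0\<close>, removes 0 from the
    domain.\<close>
  by (rule exI[of _ "Comp (Proj 0) [Proj 0, pos_guard]"])
    (auto simp: eval_simps list_all2_Cons1 eval_pos_guard)

lemma computable_on_pos_Suc: "computable_on pos Suc"
  unfolding computable_on_def
  by (rule exI[of _ "Comp (Proj 0) [Succ, pos_guard]"])
    (auto simp: eval_simps list_all2_Cons1 eval_pos_guard)

lemma computable_on_atLeast_2: "computable_on {2..} (\<lambda>x. 0)"
  unfolding computable_on_def
  \<comment> \<open>The truncated predecessor sends both 0 and 1 to 0, where the guard
    diverges.\<close>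
  by (rule exI[of _ "Comp pos_guard [pred_recf]"])
    (auto simp: eval_simps list_all2_Cons1 eval_pos_guard eval_pred_recf)

lemma bij_betw_Suc_pos: "bij_betw Suc pos {2..}"
  by (rule bij_betw_byWitness[of _ "\<lambda>x. x - 1"]) auto

lemma listing_pos: "listing pos (\<lambda>x. x)"
  using computable_on_pos_id
  unfolding listing_def listing_dom_def by (simp add: infinite_Ici bij_betw_def)

lemma listing_atLeast_2: "listing {2..} Suc"
  using bij_betw_Suc_pos computable_on_pos_Suc
  unfolding listing_def listing_dom_def by (simp add: infinite_Ici)

lemma re_pos: "re pos"
  using computable_on_pos_id by (auto simp: re_def)

lemma re_atLeast_2: "re {2..}"
  using computable_on_atLeast_2 by (auto simp: re_def)

lemma uniform_pos_atLeast_2: "pos \<sim> {2..}"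
  unfolding uniform_def
proof (intro conjI exI)
  show "pos \<approx> {2::nat..}"
    unfolding eqpoll_def using bij_betw_Suc_pos by blast
  show "uniform_listings (listing_dom pos) (\<lambda>x. x) Suc"
    by (simp add: uniform_listings_def)
qed (fact re_pos re_atLeast_2 listing_pos listing_atLeast_2)+

lemma one_reducible_pos_imp_superset: "A \<le>\<^sub>1 pos \<Longrightarrow> pos \<subseteq> A"
  by (auto simp: one_reducible_def)

theorem proposition3p4:
  "\<exists>A B :: nat set. re A \<and> re B \<and> A \<sim> B \<and> \<not> A \<equiv>\<^sub>1 B"
proof (intro exI conjI)
  show "re pos" "re {2..}" "pos \<sim> {2..}"
    by (fact re_pos re_atLeast_2 uniform_pos_atLeast_2)+
  show "\<not> pos \<equiv>\<^sub>1 {2..}"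
    \<comment> \<open>The direction \<open>{2..} \<le>\<^sub>1 pos\<close> fails: it would put 1
      into \<open>{2..}\<close>.\<close>
    using one_reducible_pos_imp_superset[of "{2..}"] by (auto simp: one_equivalent_def)
qed

end
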